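(* Let $x,y_1,\dots,y_n$ be vectors of an inner product space $(H;(\cdot,\cdot))$ over $\mathbb{K}$. Then $$\sum_{i=1}^n|(x,y_i)|^2\le n\|x\|^2\max_{1\le i,j\le n}|(y_i,y_j)|.$$
   Context: $(H;(\cdot,\cdot))$ is an inner product space over the real or complex number field $\mathbb{K}$; $\|x\|=(x,x)^{1/2}$; $n\ge 1$ is an integer. *)

theory Defs
  imports "HOL-Analysis.Inner_Product"
begin

text \<open>
  The scalar field is either the reals or the complex numbers. The class below captures exactly
  these two: by the Gelfand--Mazur theorem every \<^class>\<open>real_normed_field\<close> is isometrically
  isomorphic to one of them, and the second axiom then forces \<open>conj\<close> to be the identity,
  respectively complex conjugation.
\<close>

class real_or_complex = real_normed_field +
  fixes conj :: "'a \<Rightarrow> 'a"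
  assumes conj_add: "conj (a + b) = conj a + conj b"
    and conj_mult_self: "conj a * a = (norm a)\<^sup>2 *\<^sub>R 1"

instantiation real :: real_or_complex
begin
definition conj_real :: "real \<Rightarrow> real" where "conj_real a = a"
instance
  by standard (simp_all add: conj_real_def power2_eq_square)
end

instantiation complex :: real_or_complex
begin
definition conj_complex :: "complex \<Rightarrow> complex" where "conj_complex a = cnj a"
instance
  by standard (simp_all add: conj_complex_def complex_eq_iff cmod_power2 flip: power2_eq_square)
end

text \<open>
  Inner products are linear in the first argument and conjugate linear in the second.
  The axiom \<open>ip_nonneg\<close> says that \<open>(x, x)\<close> is a nonnegative real scalar; hence \<open>norm (ip x x)\<close> is
  \<open>(x, x)\<close> itself, viewed as a real number.
\<close>

locale inner_product_space = vector_space scale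
  for scale :: "'k::real_or_complex \<Rightarrow> 'v::ab_group_add \<Rightarrow> 'v" +
  fixes ip :: "'v \<Rightarrow> 'v \<Rightarrow> 'k"
  assumes ip_add_left: "ip (x + y) z = ip x z + ip y z"
    and ip_scale_left: "ip (scale a x) y = a * ip x y"
    and ip_conj: "ip y x = conj (ip x y)"
    and ip_nonneg: "\<exists>r\<ge>0. ip x x = of_real r"
    and ip_definite: "ip x x = 0 \<Longrightarrow> x = 0"

definition ip_norm :: "('v \<Rightarrow> 'v \<Rightarrow> 'k::real_or_complex) \<Rightarrow> 'v \<Rightarrow> real" where
  "ip_norm ip x = sqrt (norm (ip x x))"

lemma inner_product_space_real_inner:
  "inner_product_space scaleR (inner :: 'a::real_inner \<Rightarrow> 'a \<Rightarrow> real)"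
  by unfold_locales
    (auto simp: conj_real_def algebra_simps inner_add_left inner_commute intro: exI)

lemma inner_product_space_complex:
  "inner_product_space (*) (\<lambda>z w :: complex. z * cnj w)"
  by unfold_locales
    (auto simp: conj_complex_def algebra_simps complex_norm_square[symmetric]
      simp del: of_real_power intro!: exI[of _ "(norm _)\<^sup>2"])

lemma ip_norm_inner: "ip_norm inner x = norm (x :: 'a::real_inner)"
  by (simp add: ip_norm_def norm_eq_sqrt_inner)

end

theory Submission
  imports Defs
begin

text \<open>
  The Cauchy--Schwarz inequality bounds each summand \<open>|(x, y\<^sub>i)|\<^sup>2\<close> by \<open>\<parallel>x\<parallel>\<^sup>2 (y\<^sub>i, y\<^sub>i)\<close>, and
  \<open>(y\<^sub>i, y\<^sub>i)\<close> is one of the numbers over which the maximum is taken; adding the \<open>n\<close> bounds gives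
  the claim. The work lies in Cauchy--Schwarz over the abstract scalar field, for which it is enough
  to know that the conjugation fixes the real scalars and satisfies \<open>a conj(a) = |a|\<^sup>2\<close>.
\<close>

lemma conj_zero: "conj (0 :: 'a::real_or_complex) = 0"
  using conj_add[of 0 "0 :: 'a"] by simp

lemma conj_of_real: "conj (of_real r) = (of_real r :: 'a::real_or_complex)"
proof (cases "r = 0")
  case False
  have "conj (of_real r :: 'a) * of_real r = of_real r * of_real r"
    using conj_mult_self[of "of_real r :: 'a"] by (simp add: of_real_def power2_eq_square)
  with False show ?thesis by simp
qed (simp add: conj_zero)

context inner_product_space
begin

lemma ip_zero_left: "ip 0 z = 0"
  using ip_add_left[of 0 0 z] by simp

lemma ip_diff_left: "ip (u - v) z = ip u z - ip v z"
  using ip_add_left[of "u - v" v z] by simp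

lemma ip_self: "ip u u = of_real (norm (ip u u))"
  using ip_nonneg[of u] by auto

text \<open>
  Up to the factor \<open>(v, v)\<close>, the vector \<open>z = (v, v) u - (u, v) v\<close> is the component of \<open>u\<close>
  orthogonal to \<open>v\<close>, and \<open>(z, z) = (v, v) ((v, v) (u, u) - |(u, v)|\<^sup>2)\<close> has to be nonnegative.
\<close>

lemma cauchy_schwarz: "(norm (ip u v))\<^sup>2 \<le> norm (ip u u) * norm (ip v v)"
proof (cases "v = 0")
  case True
  have "ip u v = 0"
    unfolding True using ip_conj[of u 0] by (simp add: ip_zero_left conj_zero)
  then show ?thesis by simp
next
  case False
  define U where "U = norm (ip u u)"
  define V where "V = norm (ip v v)"
  define p where "p = ip u v"
  define z where "z = scale (of_real V) u - scale p v"
  have U: "ip u u = of_real U" and V: "ip v v = of_real V"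
    unfolding U_def V_def by (rule ip_self)+
  have "V > 0"
    using False ip_definite unfolding V_def by auto
  have z_left: "ip z w = of_real V * ip u w - p * ip v w" for w
    by (simp add: z_def ip_diff_left ip_scale_left)
  have "ip z v = 0"
    by (simp add: z_left V flip: p_def)
  then have vz: "ip v z = 0"
    using ip_conj[of v z] by (simp add: conj_zero)
  have "p * ip v u = of_real ((norm p)\<^sup>2)"
    using conj_mult_self[of p] ip_conj[of v u]
    by (simp add: p_def of_real_def mult.commute)
  then have "ip z u = of_real (V * U - (norm p)\<^sup>2)"
    by (simp add: z_left U)
  then have uz: "ip u z = of_real (V * U - (norm p)\<^sup>2)"
    using ip_conj[of u z] by (metis conj_of_real)
  have "ip z z = of_real (V * (V * U - (norm p)\<^sup>2))"
    unfolding z_left[of z] uz vz by simp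
  then have "V * (V * U - (norm p)\<^sup>2) \<ge> 0"
    using ip_nonneg[of z] by (metis of_real_eq_iff)
  with \<open>V > 0\<close> have "(norm p)\<^sup>2 \<le> V * U"
    by (simp add: zero_le_mult_iff)
  then show ?thesis
    by (simp add: p_def U_def V_def mult.commute)
qed

end

theorem mainTheorem4:
  fixes scale :: "'k::real_or_complex \<Rightarrow> 'v::ab_group_add \<Rightarrow> 'v"
    and ip :: "'v \<Rightarrow> 'v \<Rightarrow> 'k"
    and x :: 'v and y :: "nat \<Rightarrow> 'v" and n :: nat
  assumes "inner_product_space scale ip"
    and "n \<ge> 1"
  shows "(\<Sum>i=1..n. (norm (ip x (y i)))\<^sup>2)
    \<le> real n * (ip_norm ip x)\<^sup>2 * (MAX (i, j)\<in>{1..n} \<times> {1..n}. norm (ip (y i) (y j)))"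
    (is "_ \<le> _ * _ * ?M")
proof -
  interpret inner_product_space scale ip by fact
  have "(norm (ip x (y i)))\<^sup>2 \<le> (ip_norm ip x)\<^sup>2 * ?M" if "i \<in> {1..n}" for i
  proof -
    have "norm (ip (y i) (y i)) \<le> ?M"
      using that by (intro Max_ge) (auto intro!: image_eqI[of _ _ "(i, i)"])
    then have "norm (ip x x) * norm (ip (y i) (y i)) \<le> (ip_norm ip x)\<^sup>2 * ?M"
      by (simp add: ip_norm_def mult_left_mono)
    with cauchy_schwarz[of x "y i"] show ?thesis by linarith
  qed
  then have "(\<Sum>i=1..n. (norm (ip x (y i)))\<^sup>2) \<le> (\<Sum>i=1..n. (ip_norm ip x)\<^sup>2 * ?M)"
    by (rule sum_mono)
  then show ?thesis by (simp add: mult.assoc)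
qed

end
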